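(* Let $K\ge 1$ and let $M$ be any one of the four instrumental variable models $M_1,M_2,M_3,M_4$ (determined by assumptions (i), (ii), (iii), (iv) respectively). Under $M$, the joint distribution $P(Y(x_0),Y(x_1))$ is characterized, in terms of the observed distributions $P(X,Y\mid Z)$, by the $4K$ pairs of inequalities $$P(Y(x_i)=y) \;\le\; P(Y=y, X=i \mid Z=z) + P(X=1-i \mid Z=z),$$ $$P(Y(x_0)=y,\, Y(x_1)=\tilde y) \;\le\; P(Y=y, X=0\mid Z=z) + P(Y=\tilde y, X=1\mid Z=z),$$ with $y,\tilde y,i\in\{0,1\}$ and $z\in\{1,\ldots,K\}$. That is: let $q$ be a probability distribution on $\{0,1\}^2$ and, for each $z\in\{1,\ldots,K\}$, let $p_z$ be a probability distribution on $\{0,1\}^2$. Then there exists a distribution $P(Z,X,Y(x_0),Y(x_1))$ in $M$, with $P(Z=z)>0$ for all $z$, such that $P(Y(x_0)=y,Y(x_1)=\tilde y)=q(y,\tilde y)$ and $P(X=i,Y=y\mid Z=z)=p_z(i,y)$ for all $y,\tilde y,i\in\{0,1\}$ and all $z\in\{1,\ldots,K\}$, if and only if the displayed inequalities hold for all $y,\tilde y,i\in\{0,1\}$ and $z\in\{1,\ldots,K\}$ when $P(Y(x_0),Y(x_1))$ is replaced by $q$ and $P(X,Y\mid Z=z)$ is replaced by $p_z$.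
   Context: Treatment $X$ and response $Y$ take values in $\{0,1\}$; the instrument $Z$ takes values in $\{1,\ldots,K\}$. The potential outcomes $Y(x_0),Y(x_1)$ are $\{0,1\}$-valued random variables, where $Y(x_i)$ denotes the value of $Y$ had $X$ been set to $i$ (the exclusion restriction $Y(x,z)=Y(x)$ is assumed, so potential outcomes for $Y$ do not depend on $z$). When they are assumed to exist, $X(z_1),\ldots,X(z_K)$ are $\{0,1\}$-valued potential outcomes, $X(z_k)$ being the value of $X$ had $Z$ been set to $k$. Consistency: $Y=Y(x_i)$ on the event $X=i$ (so $P(Y=y,X=i\mid Z=z)=P(Y(x_i)=y,X=i\mid Z=z)$), and, in models in which the $X(z_k)$ exist, $X=X(z_k)$ on the event $Z=k$. The four sets of assumptions are ($\perp\!\!\!\perp$ denotes independence): (i) potential outcomes $X(z_1),\ldots,X(z_K)$ exist and $Z\perp\!\!\!\perp (Y(x_0),Y(x_1),X(z_1),\ldots,X(z_K))$ jointly; (ii) $Z\perp\!\!\!\perp (Y(x_0),Y(x_1))$ jointly (no potential outcomes for $X$ are assumed); (iii) potential outcomes $X(z_1),\ldots,X(z_K)$ exist and, for each $k\in\{1,\ldots,K\}$ and $i\in\{0,1\}$, $Z\perp\!\!\!\perp (X(z_k),Y(x_i))$; (iv) there exists a random variable $U$ such that $U\perp\!\!\!\perp Z$ and, for each $i\in\{0,1\}$, $Y(x_i)\perp\!\!\!\perp (X,Z)\mid U$ (no potential outcomes for $X$ are assumed). $M_1,M_2,M_3,M_4$ denote the sets of joint distributions $P(Z,X,Y(x_0),Y(x_1))$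 on $\{1,\ldots,K\}\times\{0,1\}^3$ that arise as the marginal of some joint distribution of all the variables posited in (i), (ii), (iii), (iv) respectively, satisfying the corresponding assumption and consistency. *)

theory Defs
  imports "HOL-Probability.Probability"
begin

text \<open>
  The library's \<^const>\<open>prob_space.indep_var\<close> forces the two random variables to have the
  same type. The following is its unfolding for variables of different types.
\<close>

definition indep_rv ::
  "'w measure \<Rightarrow> 'a measure \<Rightarrow> ('w \<Rightarrow> 'a) \<Rightarrow> 'b measure \<Rightarrow> ('w \<Rightarrow> 'b) \<Rightarrow> bool" where
  "indep_rv M A X B Y \<longleftrightarrow>
     X \<in> measurable M A \<and> Y \<in> measurable M B \<and>
     prob_space.indep_set M
       (sets (vimage_algebra (space M) X A)) (sets (vimage_algebra (space M) Y B))"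

text \<open>
  Independence of \<open>X\<close> and \<open>Y\<close> conditionally on the sigma-algebra generated by \<open>U\<close>.
\<close>

definition cond_indep_rv ::
  "'w measure \<Rightarrow> 'a measure \<Rightarrow> ('w \<Rightarrow> 'a) \<Rightarrow> 'b measure \<Rightarrow> ('w \<Rightarrow> 'b) \<Rightarrow>
     'u measure \<Rightarrow> ('w \<Rightarrow> 'u) \<Rightarrow> bool" where
  "cond_indep_rv M A X B Y N U \<longleftrightarrow>
     X \<in> measurable M A \<and> Y \<in> measurable M B \<and> U \<in> measurable M N \<and>
     (let F = vimage_algebra (space M) U N in
       \<forall>S\<in>sets A. \<forall>T\<in>sets B. AE \<omega> in M.
         real_cond_exp M F (indicator {\<omega> \<in> space M. X \<omega> \<in> S \<and> Y \<omega> \<in> T}) \<omega> =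
         real_cond_exp M F (indicator {\<omega> \<in> space M. X \<omega> \<in> S}) \<omega> *
         real_cond_exp M F (indicator {\<omega> \<in> space M. Y \<omega> \<in> T}) \<omega>)"

text \<open>
  Values of \<open>(Z, X, Y(x\<^sub>0), Y(x\<^sub>1))\<close>. The binary values 0 and 1 are \<^term>\<open>False\<close> and
  \<^term>\<open>True\<close>. Only values of \<open>Z\<close> in \<open>{1..K}\<close> will be charged.
\<close>

type_synonym iv_point = "nat \<times> bool \<times> bool \<times> bool"

definition instr :: "iv_point \<Rightarrow> nat" where
  "instr = (\<lambda>(z, x, y0, y1). z)"

definition treat :: "iv_point \<Rightarrow> bool" where
  "treat = (\<lambda>(z, x, y0, y1). x)"

definition pot_resp :: "bool \<Rightarrow> iv_point \<Rightarrow> bool" where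
  "pot_resp i = (\<lambda>(z, x, y0, y1). if i then y1 else y0)"

text \<open>
  Consistency for the response: \<open>Y = Y(x\<^sub>i)\<close> on the event \<open>X = i\<close>.
\<close>

definition resp :: "iv_point \<Rightarrow> bool" where
  "resp w = pot_resp (treat w) w"

text \<open>
  Joint laws of all the variables when the potential treatments \<open>X(z\<^sub>1), \<dots>, X(z\<^sub>K)\<close> exist;
  the second component is the vector \<open>k \<mapsto> X(z\<^sub>k)\<close>, extensional outside \<open>{1..K}\<close>.
  The last conjunct is consistency for the treatment.
\<close>

definition pot_treat_law :: "nat \<Rightarrow> (iv_point \<times> (nat \<Rightarrow> bool)) pmf \<Rightarrow> bool" where
  "pot_treat_law K Q \<longleftrightarrow>
     (\<forall>(w, xz)\<in>set_pmf Q.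
        instr w \<in> {1..K} \<and> xz \<in> {1..K} \<rightarrow>\<^sub>E (UNIV :: bool set) \<and> treat w = xz (instr w))"

definition iv_model1 :: "nat \<Rightarrow> iv_point pmf set" where
  "iv_model1 K = {P. \<exists>Q. pot_treat_law K Q \<and> P = map_pmf fst Q \<and>
     indep_rv (measure_pmf Q)
       (count_space UNIV) (\<lambda>(w, xz). instr w)
       (count_space UNIV) (\<lambda>(w, xz). (pot_resp False w, pot_resp True w, xz))}"

definition iv_model2 :: "nat \<Rightarrow> iv_point pmf set" where
  "iv_model2 K = {P. (\<forall>w\<in>set_pmf P. instr w \<in> {1..K}) \<and>
     indep_rv (measure_pmf P)
       (count_space UNIV) instr
       (count_space UNIV) (\<lambda>w. (pot_resp False w, pot_resp True w))}"

definition iv_model3 :: "nat \<Rightarrow> iv_point pmf set" where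
  "iv_model3 K = {P. \<exists>Q. pot_treat_law K Q \<and> P = map_pmf fst Q \<and>
     (\<forall>k\<in>{1..K}. \<forall>i. indep_rv (measure_pmf Q)
       (count_space UNIV) (\<lambda>(w, xz). instr w)
       (count_space UNIV) (\<lambda>(w, xz). (xz k, pot_resp i w)))}"

text \<open>
  In the latent variable model \<open>U\<close> takes values in an arbitrary measurable space \<open>N\<close> over the
  type \<open>'u\<close>, and \<open>Q\<close> is the joint law of \<open>((Z, X, Y(x\<^sub>0), Y(x\<^sub>1)), U)\<close>. As \<open>N\<close> is
  unrestricted, a \<open>U\<close> whose values embed into \<open>'u\<close> is covered by every such \<open>'u\<close>.
\<close>

definition iv_model4 :: "'u itself \<Rightarrow> nat \<Rightarrow> iv_point pmf set" where
  "iv_model4 _ K = {P. (\<forall>w\<in>set_pmf P. instr w \<in> {1..K}) \<and>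
     (\<exists>(N :: 'u measure) Q.
        prob_space Q \<and> sets Q = sets (count_space UNIV \<Otimes>\<^sub>M N) \<and>
        measure_pmf P = distr Q (count_space UNIV) fst \<and>
        indep_rv Q N snd (count_space UNIV) (\<lambda>(w, u). instr w) \<and>
        (\<forall>i. cond_indep_rv Q
           (count_space UNIV) (\<lambda>(w, u). pot_resp i w)
           (count_space UNIV) (\<lambda>(w, u). (treat w, instr w))
           N snd))}"

end

theory Submission
  imports Defs
begin

text \<open>
  The four models satisfy \<open>M\<^sub>1 \<subseteq> M\<^sub>2 \<subseteq> M\<^sub>4\<close> and \<open>M\<^sub>1 \<subseteq> M\<^sub>3\<close>. The inclusion
  \<open>M\<^sub>2 \<subseteq> M\<^sub>4\<close> holds because \<open>U = (Y(x\<^sub>0), Y(x\<^sub>1))\<close> is independent of \<open>Z\<close> under (ii), and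
  each \<open>Y(x\<^sub>i)\<close>, being a function of this \<open>U\<close>, is conditionally independent of everything
  given \<open>U\<close>. Hence it suffices to derive the inequalities in \<open>M\<^sub>3\<close> and in \<open>M\<^sub>4\<close>, and to
  realize every admissible pair \<open>(q, p)\<close> in \<open>M\<^sub>1\<close>.

  Necessity. Both families of inequalities are instances of
  \<open>P(Y(x\<^sub>0) \<in> S\<^sub>0, Y(x\<^sub>1) \<in> S\<^sub>1) \<le> P(Y \<in> S\<^sub>0, X = 0 | Z = z) + P(Y \<in> S\<^sub>1, X = 1 | Z = z)\<close>
  for sets \<open>S\<^sub>0\<close>, \<open>S\<^sub>1\<close>; a trivial \<open>S\<^sub>i\<close> gives the inequalities for a single margin.
  In \<open>M\<^sub>3\<close> one splits the event on the left according to the value of \<open>X(z)\<close>. In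
  \<open>M\<^sub>4\<close> (lemma \<open>latent_variable_bound\<close>) put \<open>a\<^sub>i = P(Y(x\<^sub>i) \<in> S\<^sub>i | U)\<close> and
  \<open>\<pi>\<^sub>i = P(X = i, Z = z | U)\<close>. Then \<open>\<pi>\<^sub>0 + \<pi>\<^sub>1 = P(Z = z)\<close>, as \<open>U\<close> is independent of \<open>Z\<close>, and
  \<open>P(Y(x\<^sub>0) \<in> S\<^sub>0, Y(x\<^sub>1) \<in> S\<^sub>1 | U) (\<pi>\<^sub>0 + \<pi>\<^sub>1) \<le> a\<^sub>0 \<pi>\<^sub>0 + a\<^sub>1 \<pi>\<^sub>1\<close>, whose right-hand side is, by
  conditional independence, the conditional probability given \<open>U\<close> of the events on the right;
  now take expectations.

  Sufficiency. For a single \<open>z\<close> the conditional law of \<open>X\<close> given \<open>(Y(x\<^sub>0), Y(x\<^sub>1))\<close> has to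
  be chosen such that the observed law becomes \<open>p\<^sub>z\<close>. This is a \<open>2 \<times> 2\<close> transportation problem
  with capacities \<open>q\<close>, which has one free parameter; the given inequalities say exactly that
  the interval for this parameter is nonempty (lemma \<open>exists_transport_plan\<close>). Then
  draw \<open>(Y(x\<^sub>0), Y(x\<^sub>1))\<close> from \<open>q\<close>, draw the \<open>X(z\<^sub>k)\<close> conditionally independently from the
  laws so obtained, and let \<open>Z\<close> be uniform and independent of all these
  (lemma \<open>iv_model1_exists\<close>).
\<close>

section \<open>Independence of random variables\<close>

lemma indep_rv_iff:
  assumes "prob_space M"
  shows "indep_rv M A X B Y \<longleftrightarrow> X \<in> measurable M A \<and> Y \<in> measurable M B \<and>
    (\<forall>S\<in>sets A. \<forall>T\<in>sets B.
       \<P>(w in M. X w \<in> S \<and> Y w \<in> T) = \<P>(w in M. X w \<in> S) * \<P>(w in M. Y w \<in> T))"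
proof -
  interpret prob_space M by fact
  have *: "indep_set (sets (vimage_algebra (space M) X A)) (sets (vimage_algebra (space M) Y B)) \<longleftrightarrow>
      (\<forall>S\<in>sets A. \<forall>T\<in>sets B.
         \<P>(w in M. X w \<in> S \<and> Y w \<in> T) = \<P>(w in M. X w \<in> S) * \<P>(w in M. Y w \<in> T))"
    if [measurable]: "X \<in> measurable M A" "Y \<in> measurable M B"
  proof -
    have XA: "sets (vimage_algebra (space M) X A) = (\<lambda>S. {w\<in>space M. X w \<in> S}) ` sets A"
      and YB: "sets (vimage_algebra (space M) Y B) = (\<lambda>T. {w\<in>space M. Y w \<in> T}) ` sets B"
      using that[THEN measurable_space]
      by (auto simp: sets_vimage_algebra2 vimage_def Int_def conj_commute)
    have Int: "{w\<in>space M. X w \<in> S} \<inter> {w\<in>space M. Y w \<in> T} = {w\<in>space M. X w \<in> S \<and> Y w \<in> T}" for S T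
      by auto
    have "(\<lambda>S. {w\<in>space M. X w \<in> S}) ` sets A \<subseteq> events" "(\<lambda>T. {w\<in>space M. Y w \<in> T}) ` sets B \<subseteq> events"
      by auto
    then show ?thesis
      unfolding indep_sets2_eq XA YB by (simp add: Int)
  qed
  then show ?thesis
    unfolding indep_rv_def by blast
qed

lemma indep_rv_compose:
  assumes "prob_space M" "indep_rv M A X B Y" "g \<in> measurable B C"
  shows "indep_rv M A X C (\<lambda>w. g (Y w))"
  unfolding indep_rv_iff[OF assms(1)]
proof (intro conjI ballI)
  have ind: "X \<in> measurable M A" "Y \<in> measurable M B"
    "\<And>S T. S \<in> sets A \<Longrightarrow> T \<in> sets B \<Longrightarrow>
       \<P>(w in M. X w \<in> S \<and> Y w \<in> T) = \<P>(w in M. X w \<in> S) * \<P>(w in M. Y w \<in> T)"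
    using assms(2) unfolding indep_rv_iff[OF assms(1)] by auto
  show "X \<in> measurable M A" "(\<lambda>w. g (Y w)) \<in> measurable M C"
    using ind assms(3) by (auto intro: measurable_compose)
  fix S T assume "S \<in> sets A" "T \<in> sets C"
  then have "g -` T \<inter> space B \<in> sets B"
    using assms(3) by (auto intro: measurable_sets)
  moreover have "Y w \<in> g -` T \<inter> space B \<longleftrightarrow> g (Y w) \<in> T" if "w \<in> space M" for w
    using measurable_space[OF ind(2) that] by auto
  ultimately show "\<P>(w in M. X w \<in> S \<and> g (Y w) \<in> T) = \<P>(w in M. X w \<in> S) * \<P>(w in M. g (Y w) \<in> T)"
    using ind(3)[OF \<open>S \<in> sets A\<close>, of "g -` T \<inter> space B"] by (simp cong: conj_cong)
qed

lemma indep_rv_sym: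
  assumes "prob_space M" "indep_rv M A X B Y"
  shows "indep_rv M B Y A X"
  using assms(2) unfolding indep_rv_iff[OF assms(1)] by (simp add: conj_commute mult.commute)

lemma indep_rv_distr_iff:
  assumes "prob_space M" "f \<in> measurable M N" "X \<in> measurable N A" "Y \<in> measurable N B"
  shows "indep_rv (distr M N f) A X B Y \<longleftrightarrow> indep_rv M A (\<lambda>w. X (f w)) B (\<lambda>w. Y (f w))"
proof -
  have N: "prob_space (distr M N f)"
    by (rule prob_space.prob_space_distr) fact+
  note [measurable] = assms(2-)
  have eq: "\<P>(v in distr M N f. P v) = \<P>(w in M. P (f w))" if "Measurable.pred N P" for P
    using that measurable_space[OF assms(2)]
    by (subst measure_distr) (auto intro!: arg_cong[where f="measure M"])
  have "\<P>(v in distr M N f. X v \<in> S \<and> Y v \<in> T) = \<P>(w in M. X (f w) \<in> S \<and> Y (f w) \<in> T)"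
    "\<P>(v in distr M N f. X v \<in> S) = \<P>(w in M. X (f w) \<in> S)"
    "\<P>(v in distr M N f. Y v \<in> T) = \<P>(w in M. Y (f w) \<in> T)"
    if [measurable]: "S \<in> sets A" "T \<in> sets B" for S T
    by (rule eq, measurable)+
  then show ?thesis
    unfolding indep_rv_iff[OF N] indep_rv_iff[OF assms(1)]
    using assms(2-) by (auto intro: measurable_compose)
qed

section \<open>Inclusions between the models\<close>

lemma iv_model1_subset_model2: "iv_model1 K \<subseteq> iv_model2 K"
proof
  fix P assume "P \<in> iv_model1 K"
  then obtain Q where Q: "pot_treat_law K Q" "P = map_pmf fst Q"
    "indep_rv (measure_pmf Q)
       (count_space UNIV) (\<lambda>(w, xz). instr w)
       (count_space UNIV) (\<lambda>(w, xz). (pot_resp False w, pot_resp True w, xz))"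
    by (auto simp: iv_model1_def)
  have "indep_rv (measure_pmf Q) (count_space UNIV) (\<lambda>v. instr (fst v))
       (count_space UNIV) (\<lambda>v. (pot_resp False (fst v), pot_resp True (fst v)))"
    using indep_rv_compose[OF _ Q(3), of "\<lambda>(y0, y1, xz). (y0, y1)" "count_space UNIV"]
    by (simp add: measure_pmf.prob_space_axioms case_prod_unfold)
  then show "P \<in> iv_model2 K"
    using Q(1)
    by (auto simp: iv_model2_def Q(2) map_pmf_rep_eq pot_treat_law_def
        indep_rv_distr_iff[OF measure_pmf.prob_space_axioms])
qed

lemma iv_model1_subset_model3: "iv_model1 K \<subseteq> iv_model3 K"
proof
  fix P assume "P \<in> iv_model1 K"
  then obtain Q where Q: "pot_treat_law K Q" "P = map_pmf fst Q"
    "indep_rv (measure_pmf Q)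
       (count_space UNIV) (\<lambda>(w, xz). instr w)
       (count_space UNIV) (\<lambda>(w, xz). (pot_resp False w, pot_resp True w, xz))"
    by (auto simp: iv_model1_def)
  have "indep_rv (measure_pmf Q) (count_space UNIV) (\<lambda>(w, xz). instr w)
       (count_space UNIV) (\<lambda>(w, xz). (xz k, pot_resp i w))" for k i
    using indep_rv_compose[OF _ Q(3), of "\<lambda>(y0, y1, xz). (xz k, if i then y1 else y0)" "count_space UNIV"]
    by (cases i) (simp_all add: measure_pmf.prob_space_axioms case_prod_unfold)
  then show "P \<in> iv_model3 K"
    using Q by (auto simp: iv_model3_def)
qed

lemma subalgebra_vimage_algebra:
  assumes "U \<in> measurable M N"
  shows "subalgebra M (vimage_algebra (space M) U N)"
  using assms by (auto simp: subalgebra_def sets_vimage_algebra2 measurable_space intro: measurable_sets)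

text \<open>
  The indicator of \<open>h U \<in> S\<close> is measurable with respect to \<open>U\<close>, so that it can be pulled out of
  conditional expectations given \<open>U\<close>. Equality with \<open>h U\<close> is required only almost surely.
\<close>

lemma cond_indep_rv_function_of:
  assumes "prob_space M" "X \<in> measurable M A" "Y \<in> measurable M B" "U \<in> measurable M N"
    and "h \<in> measurable N A" "AE w in M. X w = h (U w)"
  shows "cond_indep_rv M A X B Y N U"
  unfolding cond_indep_rv_def Let_def
proof (intro conjI ballI assms)
  fix S T assume [measurable]: "S \<in> sets A" "T \<in> sets B"
  interpret prob_space M by fact
  note [measurable] = assms(2-5)
  define F where "F = vimage_algebra (space M) U N"
  have "subalgebra M F"
    unfolding F_def by (rule subalgebra_vimage_algebra) fact
  then interpret finite_measure_subalgebra M F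
    by unfold_locales
  have UF: "U \<in> measurable F N"
    unfolding F_def using measurable_space[OF assms(4)] by (auto intro: measurable_vimage_algebra1)
  \<comment> \<open>\<open>H\<close> is a version of the indicator of \<open>X \<in> S\<close> that is measurable with respect to \<open>U\<close>.\<close>
  define H :: "'a \<Rightarrow> real" where "H = (\<lambda>w. indicator S (h (U w)))"
  have [measurable]: "H \<in> borel_measurable F"
    unfolding H_def using UF by measurable
  have [measurable]: "H \<in> borel_measurable M"
    unfolding H_def by measurable
  let ?XS = "{\<omega> \<in> space M. X \<omega> \<in> S}" and ?YT = "{\<omega> \<in> space M. Y \<omega> \<in> T}"
    and ?XY = "{\<omega> \<in> space M. X \<omega> \<in> S \<and> Y \<omega> \<in> T}"
  have "AE w in M. indicator ?XY w = H w * indicator ?YT w"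
    using assms(6) by eventually_elim (auto simp: H_def indicator_def)
  then have 1: "AE w in M. real_cond_exp M F (indicator ?XY) w =
      real_cond_exp M F (\<lambda>w. H w * indicator ?YT w) w"
    by (rule real_cond_exp_cong) measurable
  have "integrable M (\<lambda>w. H w * indicator ?YT w)"
    by (rule integrable_const_bound[where B=1]) (auto simp: H_def indicator_def)
  then have 2: "AE w in M. real_cond_exp M F (\<lambda>w. H w * indicator ?YT w) w =
      H w * real_cond_exp M F (indicator ?YT) w"
    by (intro real_cond_exp_mult) measurable
  have "AE w in M. indicator ?XS w = H w"
    using assms(6) AE_space by eventually_elim (auto simp: H_def indicator_def)
  then have 3: "AE w in M. real_cond_exp M F (indicator ?XS) w = real_cond_exp M F H w"
    by (rule real_cond_exp_cong) measurable
  have "integrable M H"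
    by (rule integrable_const_bound[where B=1]) (auto simp: H_def indicator_def)
  then have 4: "AE w in M. real_cond_exp M F H w = H w"
    by (intro real_cond_exp_F_meas) measurable
  show "AE \<omega> in M. real_cond_exp M (vimage_algebra (space M) U N) (indicator ?XY) \<omega> =
      real_cond_exp M (vimage_algebra (space M) U N) (indicator ?XS) \<omega> *
      real_cond_exp M (vimage_algebra (space M) U N) (indicator ?YT) \<omega>"
    unfolding F_def[symmetric] using 1 2 3 4 by eventually_elim simp
qed

text \<open>
  The witness is \<open>U = (Y(x\<^sub>0), Y(x\<^sub>1))\<close>, whose four values are embedded into the infinite type
  \<^typ>\<open>'u\<close>.
\<close>

lemma iv_model2_subset_model4:
  assumes "infinite (UNIV :: 'u set)"
  shows "iv_model2 K \<subseteq> iv_model4 TYPE('u) K"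
proof
  fix P assume P: "P \<in> iv_model2 K"
  have "\<exists>A. finite A \<and> card A = card (UNIV :: (bool \<times> bool) set) \<and> A \<subseteq> (UNIV :: 'u set)"
    using infinite_arbitrarily_large[OF assms] by blast
  then obtain A :: "'u set" where "finite A" "card A = card (UNIV :: (bool \<times> bool) set)"
    by blast
  then obtain e :: "bool \<times> bool \<Rightarrow> 'u" where "bij_betw e UNIV A"
    using finite_same_card_bij[of "UNIV :: (bool \<times> bool) set" A] by auto
  then have e: "inj e"
    by (rule bij_betw_imp_inj_on)
  define N :: "'u measure" where "N = count_space UNIV"
  define f where "f = (\<lambda>w. (w, e (pot_resp False w, pot_resp True w)))"
  define Q where "Q = distr P (count_space UNIV \<Otimes>\<^sub>M N) f"
  have f[measurable]: "f \<in> measurable P (count_space UNIV \<Otimes>\<^sub>M N)"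
    by (auto simp: f_def N_def space_pair_measure)
  have Qp: "prob_space Q"
    unfolding Q_def by (rule measure_pmf.prob_space_distr) (rule f)
  have setsQ[measurable_cong]: "sets Q = sets (count_space UNIV \<Otimes>\<^sub>M N)"
    by (simp add: Q_def)
  have "indep_rv P (count_space UNIV) instr (count_space UNIV) (\<lambda>w. (pot_resp False w, pot_resp True w))"
    using P by (simp add: iv_model2_def)
  then have "indep_rv P (count_space UNIV) instr N (\<lambda>w. e (pot_resp False w, pot_resp True w))"
    by (rule indep_rv_compose[OF measure_pmf.prob_space_axioms]) (simp add: N_def)
  then have "indep_rv P N (\<lambda>w. e (pot_resp False w, pot_resp True w)) (count_space UNIV) instr"
    by (rule indep_rv_sym[OF measure_pmf.prob_space_axioms])
  then have ind: "indep_rv Q N snd (count_space UNIV) (\<lambda>(w, u). instr w)"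
    unfolding Q_def
    by (subst indep_rv_distr_iff[OF measure_pmf.prob_space_axioms f]) (auto simp: f_def case_prod_beta)
  have fstQ: "measure_pmf P = distr Q (count_space UNIV) fst"
    unfolding Q_def by (subst distr_distr) (auto simp: f_def N_def o_def space_pair_measure distr_id2)
  have "cond_indep_rv Q (count_space UNIV) (\<lambda>(w, u). pot_resp i w)
           (count_space UNIV) (\<lambda>(w, u). (treat w, instr w)) N snd" for i
  proof (rule cond_indep_rv_function_of[OF Qp])
    define h where "h = (\<lambda>u. if i then snd (inv e u) else fst (inv e u))"
    show h: "h \<in> measurable N (count_space UNIV)"
      by (simp add: N_def)
    have "Measurable.pred (count_space UNIV \<Otimes>\<^sub>M N) (\<lambda>v. (case v of (w, u) \<Rightarrow> pot_resp i w) = h (snd v))"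
      using h by measurable
    then show "AE v in Q. (case v of (w, u) \<Rightarrow> pot_resp i w) = h (snd v)"
      unfolding Q_def using e
      by (subst AE_distr_iff[OF f]) (auto simp: pred_def f_def h_def inv_f_f)
  qed measurable
  then show "P \<in> iv_model4 TYPE('u) K"
    using P Qp setsQ fstQ ind by (auto simp: iv_model4_def iv_model2_def)
qed

section \<open>Necessity of the inequalities\<close>

text \<open>
  The common form of the inequalities for the value \<open>z\<close> of the instrument, in terms of the
  joint law. The condition \<open>Z = z\<close> is cleared by multiplying with \<open>P(Z = z)\<close>, so that
  no positivity is needed.
\<close>

definition causal_bounds :: "iv_point pmf \<Rightarrow> nat \<Rightarrow> bool" where
  "causal_bounds P z \<longleftrightarrow> (\<forall>S0 S1.
     \<P>(w in measure_pmf P. pot_resp False w \<in> S0 \<and> pot_resp True w \<in> S1) * \<P>(w in measure_pmf P. instr w = z)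
       \<le> \<P>(w in measure_pmf P. pot_resp False w \<in> S0 \<and> \<not> treat w \<and> instr w = z)
         + \<P>(w in measure_pmf P. pot_resp True w \<in> S1 \<and> treat w \<and> instr w = z))"

text \<open>
  This is \<open>P(Z \<in> T | U) = P(Z \<in> T)\<close>: over a set \<open>U \<in> S\<close>, both sides integrate to
  \<open>P(U \<in> S) P(Z \<in> T)\<close>.
\<close>

lemma cond_prob_const_of_indep:
  assumes "prob_space M" "indep_rv M N U C Z" "T \<in> sets C"
  shows "AE w in M. real_cond_exp M (vimage_algebra (space M) U N) (indicator {w \<in> space M. Z w \<in> T}) w
           = \<P>(w in M. Z w \<in> T)"
proof -
  interpret prob_space M by fact
  define F where "F = vimage_algebra (space M) U N"
  have ind: "U \<in> measurable M N" "Z \<in> measurable M C"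
    "\<And>S. S \<in> sets N \<Longrightarrow>
       \<P>(w in M. U w \<in> S \<and> Z w \<in> T) = \<P>(w in M. U w \<in> S) * \<P>(w in M. Z w \<in> T)"
    using assms(2,3) unfolding indep_rv_iff[OF assms(1)] by auto
  note [measurable] = ind(1,2) assms(3)
  have sub: "subalgebra M F"
    unfolding F_def by (rule subalgebra_vimage_algebra) fact
  then interpret finite_measure_subalgebra M F
    by unfold_locales
  let ?B = "{w \<in> space M. Z w \<in> T}"
  have B: "?B \<in> sets M" by measurable
  have "AE w in M. real_cond_exp M F (indicator ?B) w = prob ?B"
  proof (rule real_cond_exp_charact)
    fix A assume "A \<in> sets F"
    then obtain S where S: "S \<in> sets N" and A: "A = U -` S \<inter> space M"
      using measurable_space[OF ind(1)] by (auto simp: F_def sets_vimage_algebra2)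
    have AM: "A \<in> sets M"
      using \<open>A \<in> sets F\<close> sub by (auto simp: subalgebra_def)
    have "(LINT w:A|M. indicator ?B w) = prob (A \<inter> ?B)"
      using AM B by (simp add: set_lebesgue_integral_def indicator_inter_arith[symmetric])
    also have "A \<inter> ?B = {w\<in>space M. U w \<in> S \<and> Z w \<in> T}"
      by (auto simp: A)
    also have "prob \<dots> = prob A * prob ?B"
      using ind(3)[OF S] by (simp add: A vimage_def Int_def conj_commute)
    also have "\<dots> = (LINT w:A|M. prob ?B)"
      using AM by (simp add: set_lebesgue_integral_def)
    finally show "(LINT w:A|M. indicator ?B w) = (LINT w:A|M. prob ?B)" .
  qed (use B in \<open>auto simp: integrable_real_indicator emeasure_eq_measure\<close>)
  then show ?thesis
    by (simp add: F_def)
qed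

text \<open>
  The bound for a latent variable \<open>U\<close>. Only the separate conditional independence of
  each \<open>Y\<^sub>i\<close> from \<open>(X, Z)\<close> is used, and no joint one.
\<close>

lemma latent_variable_bound:
  fixes X :: "'w \<Rightarrow> bool"
  assumes "prob_space M"
    and indep: "indep_rv M N U (count_space UNIV) Z"
    and Y0: "cond_indep_rv M A Y0 (count_space UNIV) (\<lambda>w. (X w, Z w)) N U"
    and Y1: "cond_indep_rv M A Y1 (count_space UNIV) (\<lambda>w. (X w, Z w)) N U"
    and S: "S0 \<in> sets A" "S1 \<in> sets A"
  shows "\<P>(w in M. Y0 w \<in> S0 \<and> Y1 w \<in> S1) * \<P>(w in M. Z w = z)
    \<le> \<P>(w in M. Y0 w \<in> S0 \<and> \<not> X w \<and> Z w = z) + \<P>(w in M. Y1 w \<in> S1 \<and> X w \<and> Z w = z)"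
proof -
  interpret prob_space M by fact
  define F where "F = vimage_algebra (space M) U N"
  have "U \<in> measurable M N"
    using indep unfolding indep_rv_iff[OF assms(1)] by auto
  then have "subalgebra M F"
    unfolding F_def by (rule subalgebra_vimage_algebra)
  then interpret finite_measure_subalgebra M F
    by unfold_locales
  have [measurable]: "Y0 \<in> measurable M A" "Y1 \<in> measurable M A"
      "(\<lambda>w. (X w, Z w)) \<in> measurable M (count_space UNIV)"
    using Y0 Y1 by (auto simp: cond_indep_rv_def)
  have XZ[measurable]: "{w\<in>space M. X w = x \<and> Z w = z} \<in> sets M" for x
    using measurable_sets[OF \<open>(\<lambda>w. (X w, Z w)) \<in> measurable M (count_space UNIV)\<close>, of "{(x, z)}"]
    by (simp add: vimage_def Int_def conj_commute)
  have [measurable]: "{w\<in>space M. Z w = z} \<in> sets M"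
  proof -
    have *: "{w\<in>space M. Z w = z} = {w\<in>space M. X w = True \<and> Z w = z} \<union> {w\<in>space M. X w = False \<and> Z w = z}"
      by auto
    show ?thesis
      unfolding * by (intro sets.Un XZ)
  qed
  note [measurable] = S
  \<comment> \<open>\<open>ce E\<close> is the conditional probability of \<open>E\<close> given \<open>U\<close>.\<close>
  define ce :: "'w set \<Rightarrow> 'w \<Rightarrow> real" where "ce = (\<lambda>E. real_cond_exp M F (indicator E))"
  let ?G = "{w\<in>space M. Y0 w \<in> S0 \<and> Y1 w \<in> S1}"
  let ?A0 = "{w\<in>space M. Y0 w \<in> S0}" and ?A1 = "{w\<in>space M. Y1 w \<in> S1}"
  let ?B = "\<lambda>x. {w\<in>space M. X w = x \<and> Z w = z}" and ?C = "{w\<in>space M. Z w = z}"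
  let ?AB0 = "{w\<in>space M. Y0 w \<in> S0 \<and> X w = False \<and> Z w = z}"
  let ?AB1 = "{w\<in>space M. Y1 w \<in> S1 \<and> X w = True \<and> Z w = z}"
  have meas: "?G \<in> sets M" "?A0 \<in> sets M" "?A1 \<in> sets M" "?C \<in> sets M"
    by measurable
  have B: "?B x \<in> sets M" for x by measurable
  have AB_eq: "?AB0 = ?A0 \<inter> ?B False" "?AB1 = ?A1 \<inter> ?B True"
    by auto
  have AB: "?AB0 \<in> sets M" "?AB1 \<in> sets M"
    unfolding AB_eq by (intro sets.Int meas B)+
  have int: "integrable M (indicator E :: 'w \<Rightarrow> real)" if "E \<in> sets M" for E
    using that by (simp add: integrable_real_indicator emeasure_eq_measure)
  have ce_int: "integrable M (ce E)" "(\<integral>w. ce E w \<partial>M) = prob E" if "E \<in> sets M" for E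
    unfolding ce_def using real_cond_exp_int[OF int[OF that]] that by auto
  have ce_mono: "AE w in M. ce D w \<le> ce E w" if "D \<subseteq> E" "D \<in> sets M" "E \<in> sets M" for D E
    unfolding ce_def using that
    by (intro real_cond_exp_mono int) (auto split: split_indicator)
  have pos: "AE w in M. 0 \<le> ce (?B x) w" for x
    unfolding ce_def by (intro real_cond_exp_pos) (auto simp: B)
  have ci0: "AE w in M. ce ?AB0 w = ce ?A0 w * ce (?B False) w"
  proof -
    have "\<forall>T. AE w in M. ce {w \<in> space M. Y0 w \<in> S0 \<and> (X w, Z w) \<in> T} w
        = ce ?A0 w * ce {w \<in> space M. (X w, Z w) \<in> T} w"
      using Y0 S unfolding cond_indep_rv_def Let_def F_def ce_def by auto
    from this[THEN spec, of "{(False, z)}"] show ?thesis by simp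
  qed
  have ci1: "AE w in M. ce ?AB1 w = ce ?A1 w * ce (?B True) w"
  proof -
    have "\<forall>T. AE w in M. ce {w \<in> space M. Y1 w \<in> S1 \<and> (X w, Z w) \<in> T} w
        = ce ?A1 w * ce {w \<in> space M. (X w, Z w) \<in> T} w"
      using Y1 S unfolding cond_indep_rv_def Let_def F_def ce_def by auto
    from this[THEN spec, of "{(True, z)}"] show ?thesis by simp
  qed
  have cC: "AE w in M. ce ?C w = prob ?C"
    using cond_prob_const_of_indep[OF assms(1) indep, of "{z}"] by (simp add: ce_def F_def)
  have "indicator ?C = (\<lambda>w. indicator (?B False) w + indicator (?B True) w :: real)"
    by (auto simp: indicator_def)
  then have cB: "AE w in M. ce ?C w = ce (?B False) w + ce (?B True) w"
    unfolding ce_def using real_cond_exp_add[OF int[OF B[of False]] int[OF B[of True]]] by simp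
  have mono0: "AE w in M. ce ?G w \<le> ce ?A0 w" and mono1: "AE w in M. ce ?G w \<le> ce ?A1 w"
    by (rule ce_mono; use meas in auto)+
  have "AE w in M. ce ?G w * prob ?C \<le> ce ?AB0 w + ce ?AB1 w"
    using ci0 ci1 cC cB mono0 mono1 pos[of False] pos[of True]
  proof eventually_elim
    case (elim w)
    have "prob ?C = ce (?B False) w + ce (?B True) w"
      using elim(3,4) by linarith
    then have "ce ?G w * prob ?C = ce ?G w * ce (?B False) w + ce ?G w * ce (?B True) w"
      by (simp only: distrib_left)
    also have "\<dots> \<le> ce ?A0 w * ce (?B False) w + ce ?A1 w * ce (?B True) w"
      using elim(5-8) by (intro add_mono mult_right_mono)
    finally show ?case
      using elim(1,2) by linarith
  qed
  then have "(\<integral>w. ce ?G w * prob ?C \<partial>M) \<le> (\<integral>w. ce ?AB0 w + ce ?AB1 w \<partial>M)"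
    by (intro integral_mono_AE Bochner_Integration.integrable_add integrable_mult_left ce_int meas AB)
  also have "\<dots> = prob ?AB0 + prob ?AB1"
    using ce_int[OF AB(1)] ce_int[OF AB(2)] by (subst Bochner_Integration.integral_add) simp_all
  also have "(\<integral>w. ce ?G w * prob ?C \<partial>M) = prob ?G * prob ?C"
    using ce_int[OF meas(1)] by simp
  finally show ?thesis
    by simp
qed

lemma iv_model4_causal_bounds:
  assumes "P \<in> iv_model4 TYPE('u) K"
  shows "causal_bounds P z"
  unfolding causal_bounds_def
proof (intro allI)
  fix S0 S1 :: "bool set"
  obtain N :: "'u measure" and Q where Q: "prob_space Q" "sets Q = sets (count_space UNIV \<Otimes>\<^sub>M N)"
    "measure_pmf P = distr Q (count_space UNIV) fst"
    "indep_rv Q N snd (count_space UNIV) (\<lambda>(w, u). instr w)"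
    "\<And>i. cond_indep_rv Q (count_space UNIV) (\<lambda>(w, u). pot_resp i w)
           (count_space UNIV) (\<lambda>(w, u). (treat w, instr w)) N snd"
    using assms by (auto simp: iv_model4_def)
  note [measurable_cong] = Q(2)
  have eq: "\<P>(w in measure_pmf P. R w) = \<P>(v in Q. R (fst v))" for R
    unfolding Q(3) by (subst measure_distr) (auto intro!: arg_cong[where f="measure Q"])
  show "\<P>(w in measure_pmf P. pot_resp False w \<in> S0 \<and> pot_resp True w \<in> S1) * \<P>(w in measure_pmf P. instr w = z)
       \<le> \<P>(w in measure_pmf P. pot_resp False w \<in> S0 \<and> \<not> treat w \<and> instr w = z)
         + \<P>(w in measure_pmf P. pot_resp True w \<in> S1 \<and> treat w \<and> instr w = z)"
    unfolding eq
    using latent_variable_bound[OF Q(1), of N snd "\<lambda>v. instr (fst v)" "count_space UNIV"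
        "\<lambda>v. pot_resp False (fst v)" "\<lambda>v. treat (fst v)" "\<lambda>v. pot_resp True (fst v)" S0 S1 z]
      Q(4) Q(5)[of False] Q(5)[of True]
    by (simp add: case_prod_unfold)
qed

lemma iv_model3_causal_bounds:
  assumes "P \<in> iv_model3 K" "z \<in> {1..K}"
  shows "causal_bounds P z"
  unfolding causal_bounds_def
proof (intro allI)
  fix S0 S1 :: "bool set"
  obtain Q where Q: "pot_treat_law K Q" "P = map_pmf fst Q"
    and indep: "\<And>i. indep_rv (measure_pmf Q)
       (count_space UNIV) (\<lambda>(w, xz). instr w)
       (count_space UNIV) (\<lambda>(w, xz). (xz z, pot_resp i w))"
    using assms by (auto simp: iv_model3_def)
  have eq: "\<P>(w in measure_pmf P. R w) = \<P>(v in measure_pmf Q. R (fst v))" for R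
    by (simp add: Q(2) vimage_def)
  \<comment> \<open>On \<open>Z = z\<close> the treatment is \<open>X(z)\<close> by consistency, and \<open>(X(z), Y(x\<^sub>i))\<close> is
    independent of \<open>Z\<close>.\<close>
  have split: "\<P>(v in measure_pmf Q. pot_resp i (fst v) \<in> S \<and> treat (fst v) = x \<and> instr (fst v) = z)
      = \<P>(v in measure_pmf Q. pot_resp i (fst v) \<in> S \<and> snd v z = x) * \<P>(v in measure_pmf Q. instr (fst v) = z)"
    for i S x
  proof -
    have "\<P>(v in measure_pmf Q. pot_resp i (fst v) \<in> S \<and> treat (fst v) = x \<and> instr (fst v) = z)
        = \<P>(v in measure_pmf Q. instr (fst v) \<in> {z} \<and> (snd v z, pot_resp i (fst v)) \<in> {x} \<times> S)"
      using Q(1)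
      by (intro measure_pmf.finite_measure_eq_AE) (auto simp: AE_measure_pmf_iff pot_treat_law_def)
    also have "\<dots> = \<P>(v in measure_pmf Q. instr (fst v) \<in> {z}) *
        \<P>(v in measure_pmf Q. (snd v z, pot_resp i (fst v)) \<in> {x} \<times> S)"
      using indep[of i, unfolded indep_rv_iff[OF measure_pmf.prob_space_axioms] case_prod_unfold,
          THEN conjunct2, THEN conjunct2, rule_format, of "{z}" "{x} \<times> S"] by simp
    finally show ?thesis
      by (simp add: conj_commute mult.commute)
  qed
  have "\<P>(v in measure_pmf Q. pot_resp False (fst v) \<in> S0 \<and> pot_resp True (fst v) \<in> S1)
      \<le> measure Q ({v. pot_resp False (fst v) \<in> S0 \<and> snd v z = False} \<union> {v. pot_resp True (fst v) \<in> S1 \<and> snd v z = True})"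
    by (intro measure_pmf.finite_measure_mono) auto
  also have "\<dots> \<le> \<P>(v in measure_pmf Q. pot_resp False (fst v) \<in> S0 \<and> snd v z = False)
      + \<P>(v in measure_pmf Q. pot_resp True (fst v) \<in> S1 \<and> snd v z = True)"
    using measure_subadditive[of _ Q] by simp
  finally have "\<P>(v in measure_pmf Q. pot_resp False (fst v) \<in> S0 \<and> pot_resp True (fst v) \<in> S1)
        * \<P>(v in measure_pmf Q. instr (fst v) = z)
      \<le> (\<P>(v in measure_pmf Q. pot_resp False (fst v) \<in> S0 \<and> snd v z = False)
      + \<P>(v in measure_pmf Q. pot_resp True (fst v) \<in> S1 \<and> snd v z = True)) * \<P>(v in measure_pmf Q. instr (fst v) = z)"
    by (rule mult_right_mono) simp
  also have "\<dots> = \<P>(v in measure_pmf Q. pot_resp False (fst v) \<in> S0 \<and> treat (fst v) = False \<and> instr (fst v) = z)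
      + \<P>(v in measure_pmf Q. pot_resp True (fst v) \<in> S1 \<and> treat (fst v) = True \<and> instr (fst v) = z)"
    unfolding split by (simp only: distrib_right)
  finally show "\<P>(w in measure_pmf P. pot_resp False w \<in> S0 \<and> pot_resp True w \<in> S1) * \<P>(w in measure_pmf P. instr w = z)
       \<le> \<P>(w in measure_pmf P. pot_resp False w \<in> S0 \<and> \<not> treat w \<and> instr w = z)
         + \<P>(w in measure_pmf P. pot_resp True w \<in> S1 \<and> treat w \<and> instr w = z)"
    unfolding eq by simp
qed

lemma prob_bool_pair:
  fixes q :: "(bool \<times> bool) pmf"
  shows "measure_pmf.prob q {v. R v} =
    (if R (False, False) then pmf q (False, False) else 0) + (if R (False, True) then pmf q (False, True) else 0) +
    (if R (True, False) then pmf q (True, False) else 0) + (if R (True, True) then pmf q (True, True) else 0)"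
proof -
  have "measure_pmf.prob q {v. R v} = (\<Sum>v\<in>UNIV. if R v then pmf q v else 0)"
    using sum.inter_filter[of UNIV "pmf q" R] by (simp add: measure_measure_pmf_finite)
  also have "(UNIV :: (bool \<times> bool) set) = {(False, False), (False, True), (True, False), (True, True)}"
    by auto
  finally show ?thesis
    by simp
qed

lemma causal_bounds_imp_ineqs:
  fixes q p :: "(bool \<times> bool) pmf"
  assumes bounds: "causal_bounds P z"
    and pos: "\<P>(w in measure_pmf P. instr w = z) > 0"
    and q: "\<And>y y'. \<P>(w in measure_pmf P. pot_resp False w = y \<and> pot_resp True w = y') = pmf q (y, y')"
    and p: "\<And>i y. \<P>(w in measure_pmf P. treat w = i \<and> resp w = y \<bar> instr w = z) = pmf p (i, y)"
  shows "\<P>(v in measure_pmf q. (if i then snd v else fst v) = y)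
      \<le> pmf p (i, y) + \<P>(v in measure_pmf p. fst v = (\<not> i))" (is ?marg)
    and "pmf q (y, y') \<le> pmf p (False, y) + pmf p (True, y')" (is ?joint)
proof -
  let ?c = "\<P>(w in measure_pmf P. instr w = z)"
  have "q = map_pmf (\<lambda>w. (pot_resp False w, pot_resp True w)) P"
    by (rule pmf_eqI, safe) (simp add: q[symmetric] pmf_map vimage_def)
  then have qE: "measure_pmf.prob q {v. E v} = measure_pmf.prob P {w. E (pot_resp False w, pot_resp True w)}" for E
    by (simp add: vimage_def)
  \<comment> \<open>On \<open>X = i\<close> the response is \<open>Y(x\<^sub>i)\<close>.\<close>
  have cell: "\<P>(w in measure_pmf P. pot_resp i w = y \<and> treat w = i \<and> instr w = z) = pmf p (i, y) * ?c" for i y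
  proof -
    have "\<P>(w in measure_pmf P. pot_resp i w = y \<and> treat w = i \<and> instr w = z) =
        \<P>(w in measure_pmf P. (treat w = i \<and> resp w = y) \<and> instr w = z)"
      by (intro arg_cong[where f="measure P"]) (auto simp: resp_def)
    then show ?thesis
      using pos p[of i y] by (simp add: cond_prob_def field_simps)
  qed
  have treat: "\<P>(w in measure_pmf P. treat w = i \<and> instr w = z) = \<P>(v in measure_pmf p. fst v = i) * ?c" for i
  proof -
    have "{w. treat w = i \<and> instr w = z} =
        {w. pot_resp i w = False \<and> treat w = i \<and> instr w = z} \<union> {w. pot_resp i w = True \<and> treat w = i \<and> instr w = z}"
      by auto
    then have "\<P>(w in measure_pmf P. treat w = i \<and> instr w = z) = pmf p (i, False) * ?c + pmf p (i, True) * ?c"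
      unfolding cell[symmetric] by simp (subst measure_pmf.finite_measure_Union, auto)
    then show ?thesis
      by (cases i) (simp_all add: prob_bool_pair algebra_simps)
  qed
  have B: "\<P>(w in measure_pmf P. pot_resp False w \<in> S0 \<and> pot_resp True w \<in> S1) * ?c
       \<le> \<P>(w in measure_pmf P. pot_resp False w \<in> S0 \<and> treat w = False \<and> instr w = z)
         + \<P>(w in measure_pmf P. pot_resp True w \<in> S1 \<and> treat w = True \<and> instr w = z)" for S0 S1
    using bounds unfolding causal_bounds_def by simp
  have "pmf q (y, y') * ?c \<le> (pmf p (False, y) + pmf p (True, y')) * ?c"
    using B[of "{y}" "{y'}"] unfolding q[symmetric] by (simp only: singleton_iff cell distrib_right)
  then show ?joint
    using pos by simp
  \<comment> \<open>Take the trivial set for the potential response other than \<open>Y(x\<^sub>i)\<close>.\<close>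
  have "\<P>(v in measure_pmf q. (if i then snd v else fst v) = y) * ?c
      \<le> (pmf p (i, y) + \<P>(v in measure_pmf p. fst v = (\<not> i))) * ?c"
  proof (cases i)
    case True
    then show ?thesis
      using B[of UNIV "{y}"] by (simp add: qE treat[of False, simplified] cell[of True, simplified] distrib_right)
  next
    case False
    then show ?thesis
      using B[of "{y}" UNIV] by (simp add: qE treat[of True, simplified] cell[of False, simplified] distrib_right)
  qed
  then show ?marg
    using pos by simp
qed

section \<open>Sufficiency of the inequalities\<close>

text \<open>
  Here \<open>r (y, y')\<close> is to be the probability of \<open>Y(x\<^sub>0) = y\<close>, \<open>Y(x\<^sub>1) = y'\<close>, \<open>X = 1\<close> for one fixed value
  of the instrument. The last two conditions prescribe its column sums and, through
  \<open>q - r\<close>, its row sums. Such a \<open>r\<close> is determined by its entry \<open>t\<close> at \<open>(0, 0)\<close>, and each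
  entry bounds \<open>t\<close> from below and from above.
\<close>

lemma exists_transport_plan:
  fixes q p :: "(bool \<times> bool) pmf"
  assumes marg: "\<And>i y. \<P>(v in measure_pmf q. (if i then snd v else fst v) = y)
      \<le> pmf p (i, y) + \<P>(v in measure_pmf p. fst v = (\<not> i))"
    and joint: "\<And>y y'. pmf q (y, y') \<le> pmf p (False, y) + pmf p (True, y')"
  obtains r where "\<And>v. 0 \<le> r v" "\<And>v. r v \<le> pmf q v"
    "\<And>y. r (False, y) + r (True, y) = pmf p (True, y)"
    "\<And>y. (pmf q (y, False) - r (y, False)) + (pmf q (y, True) - r (y, True)) = pmf p (False, y)"
proof -
  have total: "pmf m (False, False) + pmf m (False, True) + pmf m (True, False) + pmf m (True, True) = 1"
    for m :: "(bool \<times> bool) pmf"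
    using prob_bool_pair[of m "\<lambda>_. True"] by (simp add: measure_pmf.prob_space[simplified])
  define q00 q01 q10 q11 where
    "q00 = pmf q (False, False)" "q01 = pmf q (False, True)"
    "q10 = pmf q (True, False)" "q11 = pmf q (True, True)"
  define p00 p01 p10 p11 where
    "p00 = pmf p (False, False)" "p01 = pmf p (False, True)"
    "p10 = pmf p (True, False)" "p11 = pmf p (True, True)"
  note pq_defs = q00_q01_q10_q11_def p00_p01_p10_p11_def
  have sums: "q00 + q01 + q10 + q11 = 1" "p00 + p01 + p10 + p11 = 1"
    using total[of q] total[of p] by (simp_all add: pq_defs)
  have nonneg: "0 \<le> q00" "0 \<le> q01" "0 \<le> q10" "0 \<le> q11" "0 \<le> p00" "0 \<le> p01" "0 \<le> p10" "0 \<le> p11"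
    by (simp_all add: pq_defs)
  have ineqs: "q00 + q01 \<le> p00 + (p10 + p11)" "q10 + q11 \<le> p01 + (p10 + p11)"
      "q00 + q10 \<le> p10 + (p00 + p01)" "q01 + q11 \<le> p11 + (p00 + p01)"
      "q00 \<le> p00 + p10" "q01 \<le> p00 + p11" "q10 \<le> p01 + p10" "q11 \<le> p01 + p11"
    using marg[of False False] marg[of False True] marg[of True False] marg[of True True]
      joint[of False False] joint[of False True] joint[of True False] joint[of True True]
    by (simp_all add: pq_defs prob_bool_pair)
  \<comment> \<open>The least \<open>t\<close> that satisfies the four lower bounds.\<close>
  define t where "t = max (max 0 (q00 - p00)) (max (p10 - q10) (p10 - (q10 + q11 - p01)))"
  define r where "r = (\<lambda>(y, y'). if y then (if y' then q10 + q11 - p01 - p10 + t else p10 - t)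
                                  else (if y' then q00 + q01 - p00 - t else t))"
  have lower: "0 \<le> t" "q00 - p00 \<le> t" "p10 - q10 \<le> t" "p10 - (q10 + q11 - p01) \<le> t"
    by (simp_all add: t_def)
  have upper: "t \<le> q00" "t \<le> q00 + q01 - p00" "t \<le> p10" "t \<le> p10 + p01 - q10"
    unfolding t_def max.bounded_iff by (intro conjI; use sums nonneg ineqs in linarith)+
  have r_vals: "r (False, False) = t" "r (False, True) = q00 + q01 - p00 - t"
      "r (True, False) = p10 - t" "r (True, True) = q10 + q11 - p01 - p10 + t"
    by (simp_all add: r_def)
  have "\<forall>y y'. 0 \<le> r (y, y') \<and> r (y, y') \<le> pmf q (y, y')"
    unfolding all_bool_eq r_vals pq_defs[symmetric] by (intro conjI; use lower upper in linarith)
  moreover have "\<forall>y. r (False, y) + r (True, y) = pmf p (True, y)"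
    unfolding all_bool_eq r_vals pq_defs[symmetric] by (intro conjI; use sums in linarith)
  moreover have "\<forall>y. (pmf q (y, False) - r (y, False)) + (pmf q (y, True) - r (y, True)) = pmf p (False, y)"
    unfolding all_bool_eq r_vals pq_defs[symmetric] by (intro conjI; use sums in linarith)
  ultimately show thesis
    by (intro that[of r]) auto
qed

text \<open>
  The law of \<open>(X, Y)\<close> when \<open>(Y(x\<^sub>0), Y(x\<^sub>1))\<close> has law \<open>q\<close>, the conditional law of \<open>X\<close> given
  \<open>(Y(x\<^sub>0), Y(x\<^sub>1)) = v\<close> is \<open>\<kappa> v\<close>, and \<open>Y = Y(x\<^sub>i)\<close> on \<open>X = i\<close>.
\<close>

definition obs_law :: "(bool \<times> bool) pmf \<Rightarrow> (bool \<times> bool \<Rightarrow> bool pmf) \<Rightarrow> (bool \<times> bool) pmf" where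
  "obs_law q \<kappa> =
     map_pmf (\<lambda>(v, x). (x, if x then snd v else fst v)) (bind_pmf q (\<lambda>v. map_pmf (Pair v) (\<kappa> v)))"

lemma exists_treatment_kernel:
  fixes q p :: "(bool \<times> bool) pmf"
  assumes marg: "\<And>i y. \<P>(v in measure_pmf q. (if i then snd v else fst v) = y)
      \<le> pmf p (i, y) + \<P>(v in measure_pmf p. fst v = (\<not> i))"
    and joint: "\<And>y y'. pmf q (y, y') \<le> pmf p (False, y) + pmf p (True, y')"
  obtains \<kappa> :: "bool \<times> bool \<Rightarrow> bool pmf" where "obs_law q \<kappa> = p"
proof -
  obtain r where r: "\<And>v. 0 \<le> r v" "\<And>v. r v \<le> pmf q v"
    "\<And>y. r (False, y) + r (True, y) = pmf p (True, y)"
    "\<And>y. (pmf q (y, False) - r (y, False)) + (pmf q (y, True) - r (y, True)) = pmf p (False, y)"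
    using exists_transport_plan[OF marg joint] by blast
  \<comment> \<open>If \<open>pmf q v = 0\<close>, the quotient is \<open>0\<close>, and the value of \<open>\<kappa> v\<close> does not matter.\<close>
  define \<kappa> where "\<kappa> = (\<lambda>v. bernoulli_pmf (r v / pmf q v))"
  have \<kappa>: "pmf q v * pmf (\<kappa> v) x = (if x then r v else pmf q v - r v)" for v x
  proof (cases "pmf q v = 0")
    case True
    then show ?thesis using r(1,2)[of v] by simp
  next
    case False
    then have "0 < pmf q v" by (simp add: pmf_pos)
    then show ?thesis
      using r(1,2)[of v] by (cases x) (simp_all add: \<kappa>_def field_simps)
  qed
  let ?D = "bind_pmf q (\<lambda>v. map_pmf (Pair v) (\<kappa> v))"
  have D: "pmf ?D (v, x) = pmf q v * pmf (\<kappa> v) x" for v x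
  proof -
    have "pmf (map_pmf (Pair v') (\<kappa> v')) (v, x) = indicator {v} v' * pmf (\<kappa> v) x" for v'
    proof (cases "v' = v")
      case True
      then show ?thesis by (simp add: pmf_map_inj' inj_def)
    next
      case False
      then show ?thesis by (auto simp: pmf_eq_0_set_pmf)
    qed
    then show ?thesis
      by (simp add: pmf_bind measure_pmf_single)
  qed
  have "map_pmf (\<lambda>(v, x). (x, if x then snd v else fst v)) ?D = p"
  proof (rule pmf_eqI, safe)
    fix i y
    have "(\<lambda>(v, x). (x, if x then snd v else fst v)) -` {(i, y)} =
        (if i then {((False, y), True), ((True, y), True)} else {((y, False), False), ((y, True), False)})"
      by (auto split: if_splits)
    then have "pmf (map_pmf (\<lambda>(v, x). (x, if x then snd v else fst v)) ?D) (i, y) =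
        (\<Sum>d\<in>(if i then {((False, y), True), ((True, y), True)} else {((y, False), False), ((y, True), False)}). pmf ?D d)"
      by (simp add: pmf_map measure_measure_pmf_finite)
    also have "\<dots> = pmf p (i, y)"
      using r(3,4)[of y] by (simp add: D \<kappa>)
    finally show "pmf (map_pmf (\<lambda>(v, x). (x, if x then snd v else fst v)) ?D) (i, y) = pmf p (i, y)" .
  qed
  then show thesis
    by (intro that) (simp add: obs_law_def)
qed

lemma indep_rv_pair_pmf:
  "indep_rv (measure_pmf (pair_pmf A B)) (count_space UNIV) fst (count_space UNIV) snd"
  unfolding indep_rv_iff[OF measure_pmf.prob_space_axioms]
proof (intro conjI ballI)
  fix S :: "'a set" and T :: "'b set"
  have "(S \<inter> set_pmf A) \<times> (T \<inter> set_pmf B) = {v. fst v \<in> S \<and> snd v \<in> T} \<inter> set_pmf (pair_pmf A B)"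
    by auto
  then have "measure_pmf.prob (pair_pmf A B) {v. fst v \<in> S \<and> snd v \<in> T}
      = measure_pmf.prob (pair_pmf A B) ((S \<inter> set_pmf A) \<times> (T \<inter> set_pmf B))"
    by (simp only: measure_Int_set_pmf)
  also have "\<dots> = measure_pmf.prob A S * measure_pmf.prob B T"
    by (subst measure_pmf_prob_product) (auto simp: measure_Int_set_pmf intro: countable_subset[OF _ countable_set_pmf])
  also have "measure_pmf.prob A S = measure_pmf.prob (map_pmf fst (pair_pmf A B)) S"
    by (simp only: map_fst_pair_pmf)
  also have "measure_pmf.prob B T = measure_pmf.prob (map_pmf snd (pair_pmf A B)) T"
    by (simp only: map_snd_pair_pmf)
  finally show "\<P>(v in measure_pmf (pair_pmf A B). fst v \<in> S \<and> snd v \<in> T) =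
      \<P>(v in measure_pmf (pair_pmf A B). fst v \<in> S) * \<P>(v in measure_pmf (pair_pmf A B). snd v \<in> T)"
    by (simp add: vimage_def)
qed auto

text \<open>
  Arbitrary treatment kernels \<open>\<kappa> z\<close>, one for each value of the instrument, can be realized
  simultaneously in the first model.
\<close>

lemma iv_model1_exists:
  fixes q :: "(bool \<times> bool) pmf" and \<kappa> :: "nat \<Rightarrow> bool \<times> bool \<Rightarrow> bool pmf"
  assumes "K \<ge> 1"
  obtains P where "P \<in> iv_model1 K"
    "\<And>z. z \<in> {1..K} \<Longrightarrow> \<P>(w in measure_pmf P. instr w = z) > 0"
    "map_pmf (\<lambda>w. (pot_resp False w, pot_resp True w)) P = q"
    "\<And>z i y. z \<in> {1..K} \<Longrightarrow> \<P>(w in measure_pmf P. (treat w = i \<and> resp w = y) \<and> instr w = z) =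
       pmf (obs_law q (\<kappa> z)) (i, y) * \<P>(w in measure_pmf P. instr w = z)"
proof -
  \<comment> \<open>\<open>L\<close> is the law of the potential responses and treatments, \<open>R\<close> adjoins an independent uniform
    \<open>Z\<close>, and \<open>f\<close> computes the treatment by consistency. The default value of the product law
    is the one that makes \<open>k \<mapsto> X(z\<^sub>k)\<close> extensional.\<close>
  define L where "L = bind_pmf q (\<lambda>v. map_pmf (Pair v) (Pi_pmf {1..K} undefined (\<lambda>k. \<kappa> k v)))"
  define R where "R = pair_pmf (pmf_of_set {1..K}) L"
  define f where "f = (\<lambda>(z::nat, v::bool \<times> bool, xz::nat \<Rightarrow> bool). ((z, xz z, fst v, snd v), xz))"
  define Q where "Q = map_pmf f R"
  define P where "P = map_pmf fst Q"
  have ne: "{1..K} \<noteq> {}" using assms by auto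
  have setR: "set_pmf R = {1..K} \<times> set_pmf L"
    unfolding R_def using ne by (simp add: set_pmf_of_set)
  have setL: "xz \<in> {1..K} \<rightarrow>\<^sub>E UNIV" if "(v, xz) \<in> set_pmf L" for v xz
  proof -
    from that have "xz \<in> set_pmf (Pi_pmf {1..K} undefined (\<lambda>k. \<kappa> k v))"
      by (auto simp: L_def)
    then have "\<forall>k. k \<notin> {1..K} \<longrightarrow> xz k = undefined"
      using set_Pi_pmf_subset[of "{1..K}" undefined "\<lambda>k. \<kappa> k v"] by auto
    then show ?thesis by (auto simp: PiE_def extensional_def)
  qed
  have law: "pot_treat_law K Q"
    using setL by (fastforce simp: pot_treat_law_def Q_def setR f_def instr_def treat_def)
  have indR: "indep_rv (measure_pmf R) (count_space UNIV) fst (count_space UNIV) snd"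
    unfolding R_def by (rule indep_rv_pair_pmf)
  have "indep_rv (measure_pmf R) (count_space UNIV) fst
      (count_space UNIV) (\<lambda>d. (fst (fst (snd d)), snd (fst (snd d)), snd (snd d)))"
    by (rule indep_rv_compose[OF measure_pmf.prob_space_axioms indR]) simp
  then have "indep_rv (measure_pmf Q) (count_space UNIV) (\<lambda>(w, xz). instr w)
       (count_space UNIV) (\<lambda>(w, xz). (pot_resp False w, pot_resp True w, xz))"
    unfolding Q_def map_pmf_rep_eq
    by (subst indep_rv_distr_iff[OF measure_pmf.prob_space_axioms])
      (auto simp: f_def case_prod_unfold instr_def pot_resp_def)
  then have 1: "P \<in> iv_model1 K"
    using law unfolding iv_model1_def P_def by blast
  have PR: "P = map_pmf (\<lambda>d. fst (f d)) R"
    by (simp add: P_def Q_def map_pmf_comp)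
  have prob: "\<P>(w in measure_pmf P. E w) = \<P>(d in measure_pmf R. E (fst (f d)))" for E
    by (simp add: PR vimage_def)
  have instr: "\<P>(w in measure_pmf P. instr w = z) = \<P>(d in measure_pmf R. fst d = z)" for z
    unfolding prob by (simp add: f_def instr_def case_prod_unfold)
  have fstR: "map_pmf fst R = pmf_of_set {1..K}"
    by (simp add: R_def map_fst_pair_pmf)
  have sndR: "map_pmf snd R = L"
    by (simp add: R_def map_snd_pair_pmf)
  have 2: "\<P>(w in measure_pmf P. instr w = z) > 0" if "z \<in> {1..K}" for z
  proof -
    have "\<P>(w in measure_pmf P. instr w = z) = pmf (map_pmf fst R) z"
      unfolding instr by (simp add: pmf_map vimage_def)
    then show ?thesis
      using that ne unfolding fstR by (simp add: pmf_of_set)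
  qed
  have "map_pmf fst L = q"
    by (simp add: L_def map_bind_pmf map_pmf_comp bind_return_pmf')
  moreover have "map_pmf (\<lambda>w. (pot_resp False w, pot_resp True w)) P = map_pmf fst (map_pmf snd R)"
    by (simp add: PR map_pmf_comp f_def pot_resp_def case_prod_unfold)
  ultimately have 3: "map_pmf (\<lambda>w. (pot_resp False w, pot_resp True w)) P = q"
    by (simp add: sndR)
  have 4: "\<P>(w in measure_pmf P. (treat w = i \<and> resp w = y) \<and> instr w = z) =
       pmf (obs_law q (\<kappa> z)) (i, y) * \<P>(w in measure_pmf P. instr w = z)" if "z \<in> {1..K}" for z i y
  proof -
    let ?g = "\<lambda>(v, x). (x, if x then snd v else fst v)" and ?h = "\<lambda>(v :: bool \<times> bool, xz :: nat \<Rightarrow> bool). (v, xz z)"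
    have hL: "map_pmf ?h L = bind_pmf q (\<lambda>v. map_pmf (Pair v) (\<kappa> z v))"
    proof -
      have "map_pmf (\<lambda>xz. (v, xz z)) (Pi_pmf {1..K} undefined (\<lambda>k. \<kappa> k v)) = map_pmf (Pair v) (\<kappa> z v)" for v
      proof -
        have "map_pmf (\<lambda>xz. (v, xz z)) (Pi_pmf {1..K} undefined (\<lambda>k. \<kappa> k v)) =
          map_pmf (Pair v) (map_pmf (\<lambda>xz. xz z) (Pi_pmf {1..K} undefined (\<lambda>k. \<kappa> k v)))"
          by (simp add: map_pmf_comp)
        then show ?thesis
          using that by (simp add: Pi_pmf_component)
      qed
      then show ?thesis
        by (simp add: L_def map_bind_pmf map_pmf_comp)
    qed
    have "map_pmf ?g (map_pmf ?h L) = map_pmf (\<lambda>d. ?g (?h (snd d))) R"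
      by (simp only: sndR[symmetric] map_pmf_comp)
    then have "pmf (obs_law q (\<kappa> z)) (i, y) = pmf (map_pmf (\<lambda>d. ?g (?h (snd d))) R) (i, y)"
      by (simp only: hL obs_law_def)
    also have "\<dots> = \<P>(d in measure_pmf R. snd d \<in> {l. ?g (?h l) = (i, y)})"
      by (simp add: pmf_map vimage_def)
    finally have *: "pmf (obs_law q (\<kappa> z)) (i, y) =
        \<P>(d in measure_pmf R. snd d \<in> {l. ?g (?h l) = (i, y)})" .
    have "\<P>(w in measure_pmf P. (treat w = i \<and> resp w = y) \<and> instr w = z) =
        \<P>(d in measure_pmf R. fst d \<in> {z} \<and> snd d \<in> {l. ?g (?h l) = (i, y)})"
      unfolding prob
      by (intro arg_cong[where f="measure R"])
        (auto simp: f_def treat_def resp_def pot_resp_def instr_def)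
    also have "\<dots> = \<P>(d in measure_pmf R. fst d \<in> {z}) * \<P>(d in measure_pmf R. snd d \<in> {l. ?g (?h l) = (i, y)})"
      by (rule indR[unfolded indep_rv_iff[OF measure_pmf.prob_space_axioms], THEN conjunct2, THEN conjunct2, rule_format])
        simp_all
    finally show ?thesis
      unfolding * instr by simp
  qed
  show thesis
    by (rule that[OF 1 2 3 4])
qed

theorem theorem1:
  fixes K :: nat
    and M :: "iv_point pmf set"
    and q :: "(bool \<times> bool) pmf"
    and p :: "nat \<Rightarrow> (bool \<times> bool) pmf"
  assumes "K \<ge> 1"
    and "infinite (UNIV :: 'u set)"
    and "M \<in> {iv_model1 K, iv_model2 K, iv_model3 K, iv_model4 TYPE('u) K}"
  shows "(\<exists>P\<in>M.
            (\<forall>z\<in>{1..K}. \<P>(w in measure_pmf P. instr w = z) > 0) \<and>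
            (\<forall>y y'. \<P>(w in measure_pmf P. pot_resp False w = y \<and> pot_resp True w = y') = pmf q (y, y')) \<and>
            (\<forall>z\<in>{1..K}. \<forall>i y.
               \<P>(w in measure_pmf P. treat w = i \<and> resp w = y \<bar> instr w = z) = pmf (p z) (i, y)))
     \<longleftrightarrow>
         (\<forall>z\<in>{1..K}. \<forall>y y' i.
            \<P>(v in measure_pmf q. (if i then snd v else fst v) = y)
              \<le> pmf (p z) (i, y) + \<P>(v in measure_pmf (p z). fst v = (\<not> i)) \<and>
            pmf q (y, y') \<le> pmf (p z) (False, y) + pmf (p z) (True, y'))"
    (is "?realizable \<longleftrightarrow> ?inequalities")
proof
  assume ?realizable
  then obtain P where "P \<in> M"
    and P: "\<And>z. z \<in> {1..K} \<Longrightarrow> \<P>(w in measure_pmf P. instr w = z) > 0"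
      "\<And>y y'. \<P>(w in measure_pmf P. pot_resp False w = y \<and> pot_resp True w = y') = pmf q (y, y')"
      "\<And>z i y. z \<in> {1..K} \<Longrightarrow>
         \<P>(w in measure_pmf P. treat w = i \<and> resp w = y \<bar> instr w = z) = pmf (p z) (i, y)"
    by blast
  have "P \<in> iv_model3 K \<or> P \<in> iv_model4 TYPE('u) K"
    using \<open>P \<in> M\<close> assms(3) iv_model1_subset_model3[of K] iv_model2_subset_model4[OF assms(2), of K] by auto
  then have "causal_bounds P z" if "z \<in> {1..K}" for z
    using that iv_model3_causal_bounds iv_model4_causal_bounds by blast
  note bounds = causal_bounds_imp_ineqs[OF this P(1) P(2) P(3)]
  show ?inequalities
    by (intro ballI allI conjI bounds)
next
  assume ineqs: ?inequalities
  have "\<exists>\<kappa>. obs_law q \<kappa> = p z" if "z \<in> {1..K}" for z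
  proof -
    from ineqs that have "\<P>(v in measure_pmf q. (if i then snd v else fst v) = y)
        \<le> pmf (p z) (i, y) + \<P>(v in measure_pmf (p z). fst v = (\<not> i))"
      and "pmf q (y, y') \<le> pmf (p z) (False, y) + pmf (p z) (True, y')" for i y y'
      by auto
    then show ?thesis
      by (rule exists_treatment_kernel[of q "p z"]) blast
  qed
  then have "\<forall>z\<in>{1..K}. \<exists>\<kappa>. obs_law q \<kappa> = p z"
    by (rule ballI)
  from bchoice[OF this] obtain \<kappa> where \<kappa>: "\<forall>z\<in>{1..K}. obs_law q (\<kappa> z) = p z" ..
  obtain P where P: "P \<in> iv_model1 K"
    "\<And>z. z \<in> {1..K} \<Longrightarrow> \<P>(w in measure_pmf P. instr w = z) > 0"
    "map_pmf (\<lambda>w. (pot_resp False w, pot_resp True w)) P = q"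
    "\<And>z i y. z \<in> {1..K} \<Longrightarrow> \<P>(w in measure_pmf P. (treat w = i \<and> resp w = y) \<and> instr w = z) =
       pmf (obs_law q (\<kappa> z)) (i, y) * \<P>(w in measure_pmf P. instr w = z)"
    by (rule iv_model1_exists[OF assms(1), of q \<kappa>]) (rule that; blast)
  have "P \<in> M"
    using P(1) assms(3) iv_model1_subset_model2[of K] iv_model1_subset_model3[of K]
      iv_model2_subset_model4[OF assms(2), of K] by auto
  moreover have "\<P>(w in measure_pmf P. pot_resp False w = y \<and> pot_resp True w = y') = pmf q (y, y')" for y y'
    unfolding P(3)[symmetric] by (simp add: pmf_map vimage_def)
  moreover have "\<P>(w in measure_pmf P. treat w = i \<and> resp w = y \<bar> instr w = z) = pmf (p z) (i, y)"
    if "z \<in> {1..K}" for z i y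
    using P(2,4)[OF that] by (simp add: cond_prob_def bspec[OF \<kappa> that])
  ultimately show ?realizable
    using P(2) by blast
qed

end
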